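(* The $G$-orbits of $\mathcal{C}_{3,0}$ are the orbits of the three points $$(0,0,0,0,0,0,0,0,0),\qquad (0,0,0,0,\sqrt[3]{6},0,0,0,1),\qquad (0,0,0,0,0,0,0,0,1),$$ where points of $\mathcal{C}_{3,0}$ are written in the coordinates $(a_1,a_2,\dots,a_9)$.
   Context: $\mathcal{M}_3$ is the algebra of complex $3\times3$ matrices; $\mathrm{GL}_3=\mathrm{GL}_3(\mathbb{C})$ acts on $\mathcal{M}_3\times\mathcal{M}_3$ by simultaneous conjugation. For $(X,Y)$ put $A=X-\frac13\mathrm{Tr}(X)I_3$, $B=Y-\frac13\mathrm{Tr}(Y)I_3$ and $a_1=\mathrm{Tr}(X)$, $a_2=\mathrm{Tr}(Y)$, $a_3=\mathrm{Tr}(A^2)$, $a_4=\mathrm{Tr}(AB)$, $a_5=\mathrm{Tr}(B^2)$, $a_6=\mathrm{Tr}(A^3)$, $a_7=\mathrm{Tr}(A^2B)$, $a_8=\mathrm{Tr}(AB^2)$, $a_9=\mathrm{Tr}(B^3)$, $v=\mathrm{Tr}(A^2B^2)-\mathrm{Tr}(ABAB)$, $w=\mathrm{Tr}(A^2B^2AB)-\mathrm{Tr}(A^2BAB^2)$. These eleven functions generate $\mathbb{C}[\mathcal{M}_3\times\mathcal{M}_3]^{\mathrm{GL}_3}$ and so serve as coordinates on $(\mathcal{M}_3\times\mathcal{M}_3)/\!/\mathrm{GL}_3$. $\mathcal{C}_{3,0}$ is the subvariety of $(\mathcal{M}_3\times\mathcal{M}_3)/\!/\mathrm{GL}_3$ of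 points with $v=w=0$ satisfying $a_3a_9-2a_4a_8+a_5a_7=0$, $a_5a_6-2a_4a_7+a_3a_8=0$, $a_3^2a_5-a_3a_4^2+6a_6a_8-6a_7^2=0$, $a_3a_4a_5-a_4^3+3a_6a_9-3a_7a_8=0$, $a_3a_5^2-a_4^2a_5+6a_7a_9-6a_8^2=0$; its coordinate ring is $\mathbb{C}[a_1,\dots,a_9]$ modulo these five polynomials. $G$ (the affine Cremona group) is the group generated by the unimodular automorphisms $\Phi_p$ ($x\mapsto x+p(y)$, $y\mapsto y$) and $\Psi_q$ ($x\mapsto x$, $y\mapsto y+q(x)$) of $\mathbb{C}[x,y]$, where $p,q$ are one-variable complex polynomials. It acts on $(\mathcal{M}_3\times\mathcal{M}_3)/\!/\mathrm{GL}_3$ via $\Phi_p:(X,Y)\mapsto(X+p(Y),Y)$, $\Psi_q:(X,Y)\mapsto(X,Y+q(X))$; this action leaves $v$ and $w$ invariant, and the $G$-orbits are those of the induced action on $\mathcal{C}_{3,0}$. *)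

theory Defs
  imports
    "HOL-Analysis.Analysis"
    "HOL-Computational_Algebra.Polynomial"
    "HOL-Algebra.Generated_Groups"
    "HOL-Algebra.Group_Action"
begin

section \<open>Pairs of matrices and the coordinates on the quotient\<close>

type_synonym mat3 = "complex^3^3"

text \<open>On the type \<open>complex^3^3\<close> the operations \<open>*\<close> and \<open>^\<close> are entrywise; the matrix product is
  \<open>**\<close>, and \<open>mat c\<close> is the scalar matrix with diagonal entry \<open>c\<close>.\<close>

definition poly_mat :: "complex poly \<Rightarrow> mat3 \<Rightarrow> mat3" where
  "poly_mat p M = (\<Sum>i\<le>degree p. mat (coeff p i) ** (((**) M) ^^ i) (mat 1))"

definition traceless :: "mat3 \<Rightarrow> mat3" where
  "traceless M = M - mat (trace M / 3)"

text \<open>A tuple lists the values of \<open>(a1, \<dots>, a9, v, w)\<close>.\<close>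

type_synonym point =
  "complex \<times> complex \<times> complex \<times> complex \<times> complex \<times> complex \<times> complex \<times> complex \<times> complex
    \<times> complex \<times> complex"

fun coords :: "mat3 \<times> mat3 \<Rightarrow> point" where
  "coords (X, Y) =
    (let A = traceless X; B = traceless Y in
      (trace X,
       trace Y,
       trace (A ** A),
       trace (A ** B),
       trace (B ** B),
       trace (A ** A ** A),
       trace (A ** A ** B),
       trace (A ** B ** B),
       trace (B ** B ** B),
       trace (A ** A ** B ** B) - trace (A ** B ** A ** B),
       trace (A ** A ** B ** B ** A ** B) - trace (A ** A ** B ** A ** B ** B)))"

text \<open>The eleven functions generate the algebra of invariants, so they embed the quotient
  \<open>(M_3 \<times> M_3)//GL_3\<close> in affine space of dimension 11. As \<open>GL_3\<close> is reductive, the quotient map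
  is surjective. Hence the points of the quotient are the values of \<open>coords\<close>.\<close>

definition mat_quotient :: "point set" where
  "mat_quotient = range coords"

definition C30 :: "point set" where
  "C30 = {(a1, a2, a3, a4, a5, a6, a7, a8, a9, v, w).
     (a1, a2, a3, a4, a5, a6, a7, a8, a9, v, w) \<in> mat_quotient \<and>
     v = 0 \<and> w = 0 \<and>
     a3 * a9 - 2 * a4 * a8 + a5 * a7 = 0 \<and>
     a5 * a6 - 2 * a4 * a7 + a3 * a8 = 0 \<and>
     a3^2 * a5 - a3 * a4^2 + 6 * a6 * a8 - 6 * a7^2 = 0 \<and>
     a3 * a4 * a5 - a4^3 + 3 * a6 * a9 - 3 * a7 * a8 = 0 \<and>
     a3 * a5^2 - a4^2 * a5 + 6 * a7 * a9 - 6 * a8^2 = 0}"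


section \<open>The affine Cremona group\<close>

text \<open>\<open>\<complex>[x,y]\<close> is represented as \<open>\<complex>[x][y]\<close>: the inner polynomial variable is \<open>x\<close>, the outer
  one is \<open>y\<close>.\<close>

type_synonym cxy = "complex poly poly"

definition const_xy :: "complex \<Rightarrow> cxy" where "const_xy c = [:[:c:]:]"

definition var_x :: cxy where "var_x = [:[:0, 1:]:]"

definition var_y :: cxy where "var_y = [:0, 1:]"

definition eval_xy :: "complex poly \<Rightarrow> cxy \<Rightarrow> cxy" where
  "eval_xy p f = poly (map_poly const_xy p) f"

text \<open>\<open>subst_xy f g\<close> is the endomorphism of the \<open>\<complex>\<close>-algebra \<open>\<complex>[x,y]\<close> with \<open>x \<mapsto> f\<close> and
  \<open>y \<mapsto> g\<close>.\<close>

definition subst_xy :: "cxy \<Rightarrow> cxy \<Rightarrow> cxy \<Rightarrow> cxy" where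
  "subst_xy f g h = poly (map_poly (\<lambda>c. eval_xy c f) h) g"

definition Phi :: "complex poly \<Rightarrow> cxy \<Rightarrow> cxy" where
  "Phi p = subst_xy (var_x + eval_xy p var_y) var_y"

definition Psi :: "complex poly \<Rightarrow> cxy \<Rightarrow> cxy" where
  "Psi q = subst_xy var_x (var_y + eval_xy q var_x)"

definition cremona_group :: "(cxy \<Rightarrow> cxy) monoid" where
  "cremona_group = subgroup_generated (BijGroup UNIV) (range Phi \<union> range Psi)"


section \<open>The action on the quotient\<close>

fun Phi_mat :: "complex poly \<Rightarrow> mat3 \<times> mat3 \<Rightarrow> mat3 \<times> mat3" where
  "Phi_mat p (X, Y) = (X + poly_mat p Y, Y)"

fun Psi_mat :: "complex poly \<Rightarrow> mat3 \<times> mat3 \<Rightarrow> mat3 \<times> mat3" where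
  "Psi_mat q (X, Y) = (X, Y + poly_mat q X)"

text \<open>\<open>cremona_lift g T\<close>: some expression of \<open>g\<close> as a product of the generators gives rise to the
  transformation \<open>T\<close> of pairs of matrices. Substitution is contravariant: if \<open>g\<close> sends \<open>(x, y)\<close> to
  \<open>(g x, g y)\<close>, then \<open>g \<circ> Phi p\<close> sends \<open>x\<close> to \<open>g x + p (g y)\<close>, so that on pairs of matrices
  \<open>Phi_mat p\<close> is applied last. As \<open>Phi (- p)\<close> and \<open>Psi (- q)\<close> are the inverses of \<open>Phi p\<close> and
  \<open>Psi q\<close>, every element of the group has at least one lift.\<close>

inductive cremona_lift :: "(cxy \<Rightarrow> cxy) \<Rightarrow> (mat3 \<times> mat3 \<Rightarrow> mat3 \<times> mat3) \<Rightarrow> bool" where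
  "cremona_lift id id"
| "cremona_lift g T \<Longrightarrow> cremona_lift (g \<circ> Phi p) (Phi_mat p \<circ> T)"
| "cremona_lift g T \<Longrightarrow> cremona_lift (g \<circ> Psi q) (Psi_mat q \<circ> T)"

text \<open>The induced action on the quotient, where the choice of the lift and of the representing
  pair does not matter. Because of the contravariance,
  \<open>cremona_action (g \<circ> h) c = cremona_action h (cremona_action g c)\<close>, that is, the group acts on
  the right; replacing \<open>g\<close> by its inverse to get a left action does not change the orbits.\<close>

definition cremona_action :: "(cxy \<Rightarrow> cxy) \<Rightarrow> point \<Rightarrow> point" where
  "cremona_action g c =
    (THE d. \<exists>T P. cremona_lift g T \<and> coords P = c \<and> coords (T P) = d)"

end

(* Solving the five equations for power sums shows that every point of C30 is the image of a pair of
   diagonal matrices, that is, of an unordered triple of points of the plane; this is where the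
   normal forms come from. On diagonal pairs the group acts by applying the corresponding polynomial
   automorphism of the plane to the three points. The action is well defined because, by
   Cayley-Hamilton, the coordinates of (X + p(Y), Y) depend only on those of (X, Y), while v and w are
   multiples of the traces of the square and the cube of [A,B], which does not change. After a shear
   that separates the points by their second coordinates, Lagrange interpolation moves any triple to
   any other triple with the same coincidences, so the orbits of C30 correspond to the three patterns
   of coincidence. They are separated by a5 and a9. *)

theory Submission
  imports Defs "HOL-Computational_Algebra.Fundamental_Theorem_Algebra"
begin

section \<open>Traces and polynomials of matrices\<close>

lemma matrix_sub_ldistrib: "A ** (B - C) = A ** B - A ** C"
  for A :: "'a::ring_1^'n^'m" and B C :: "'a^'k^'n"
  by (vector matrix_matrix_mult_def sum_subtractf right_diff_distrib)

lemma matrix_sub_rdistrib: "(A - B) ** C = A ** C - B ** C"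
  for A B :: "'a::ring_1^'n^'m" and C :: "'a^'k^'n"
  by (vector matrix_matrix_mult_def sum_subtractf left_diff_distrib)

lemma matrix_add_rdistrib: "(A + B) ** C = A ** C + B ** C"
  for A B :: "'a::semiring_1^'n^'m" and C :: "'a^'k^'n"
  by (vector matrix_matrix_mult_def sum.distrib distrib_right)

lemmas matrix_distribs = matrix_add_ldistrib matrix_add_rdistrib
  matrix_sub_ldistrib matrix_sub_rdistrib trace_add trace_sub

lemma mat_mult_entry: "(mat c ** M) $ i $ j = c * M $ i $ j"
  for M :: "'a::comm_semiring_1^'n^'m"
  by (simp add: matrix_matrix_mult_def mat_def if_distrib[of "\<lambda>x. x * _"] cong: if_cong)

lemma mat_mult_commute: "mat c ** M = M ** mat c"
  for M :: "'a::comm_semiring_1^'n^'n"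
  by (simp add: matrix_matrix_mult_def mat_def vec_eq_iff if_distrib[of "\<lambda>x. x * _"]
      if_distrib[of "\<lambda>x. _ * x"] ac_simps cong: if_cong)

lemma mat_mult_mat: "mat c ** mat d = (mat (c * d) :: 'a::comm_semiring_1^'n^'n)"
  by (simp add: vec_eq_iff mat_mult_entry) (simp add: mat_def)

lemma mat_add: "mat (c + d) = (mat c + mat d :: 'a::comm_semiring_1^'n^'n)"
  by (simp add: vec_eq_iff mat_def)

lemma trace_mat_mult: "trace (mat c ** M) = c * trace M"
  for M :: "'a::comm_semiring_1^'n^'n"
  by (simp add: trace_def mat_mult_entry sum_distrib_left)

lemma trace_mat3: "trace (mat c :: mat3) = 3 * c"
  by (simp add: trace_def mat_def sum_3)

lemma trace_traceless [simp]: "trace (traceless M) = 0"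
  by (simp add: traceless_def trace_sub trace_mat3)

lemma matrix_mult_sum_right: "M ** sum f S = (\<Sum>i\<in>S. M ** f i)"
  for M :: "'a::semiring_1^'n^'m" and f :: "'b \<Rightarrow> 'a^'k^'n"
  by (induction S rule: infinite_finite_induct) (auto simp: matrix_add_ldistrib)

section \<open>Polynomials in one matrix as a homomorphic image of the polynomial ring\<close>

lemma poly_mat_atMost:
  assumes "degree p \<le> n"
  shows "poly_mat p M = (\<Sum>i\<le>n. mat (coeff p i) ** ((**) M ^^ i) (mat 1))"
  unfolding poly_mat_def
  by (rule sum.mono_neutral_left) (use assms in \<open>auto simp: coeff_eq_0\<close>)

lemma poly_mat_0 [simp]: "poly_mat 0 M = 0"
  by (simp add: poly_mat_def)

lemma poly_mat_pCons: "poly_mat (pCons a p) M = mat a + M ** poly_mat p M"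
proof -
  have "poly_mat (pCons a p) M
      = (\<Sum>i\<le>Suc (degree p). mat (coeff (pCons a p) i) ** ((**) M ^^ i) (mat 1))"
    by (rule poly_mat_atMost) (rule degree_pCons_le)
  also have "\<dots> = mat a + (\<Sum>i\<le>degree p. mat (coeff p i) ** (M ** ((**) M ^^ i) (mat 1)))"
    by (subst sum.atMost_Suc_shift) simp
  also have "(\<Sum>i\<le>degree p. mat (coeff p i) ** (M ** ((**) M ^^ i) (mat 1))) = M ** poly_mat p M"
  proof -
    have "mat c ** (M ** N) = M ** (mat c ** N)" for c and N :: mat3
      by (metis mat_mult_commute matrix_mul_assoc)
    then show ?thesis
      by (simp add: poly_mat_def matrix_mult_sum_right)
  qed
  finally show ?thesis .
qed

lemma poly_mat_add: "poly_mat (p + q) M = poly_mat p M + poly_mat q M"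
proof (induction p q rule: poly_induct2)
  case (pCons a p b q)
  then show ?case
    by (simp add: poly_mat_pCons mat_add matrix_add_ldistrib)
qed simp

lemma poly_mat_smult: "poly_mat (smult c p) M = mat c ** poly_mat p M"
proof (induction p)
  case (pCons a p)
  have "M ** (mat c ** poly_mat p M) = mat c ** (M ** poly_mat p M)"
    by (metis mat_mult_commute matrix_mul_assoc)
  with pCons show ?case
    by (simp add: poly_mat_pCons matrix_add_ldistrib mat_mult_mat)
qed simp

lemma poly_mat_mult: "poly_mat (p * q) M = poly_mat p M ** poly_mat q M"
  by (induction p)
     (simp_all add: poly_mat_pCons poly_mat_add poly_mat_smult matrix_add_rdistrib matrix_mul_assoc)

lemma poly_mat_const: "poly_mat [:c:] M = mat c"
  by (simp add: poly_mat_pCons)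

lemma poly_mat_commute: "poly_mat p M ** poly_mat q M = poly_mat q M ** poly_mat p M"
  by (metis mult.commute poly_mat_mult)

section \<open>Cayley-Hamilton and traces of words in two traceless matrices\<close>

lemma Cayley_Hamilton_traceless:
  assumes "trace (B::mat3) = 0"
  shows "B ** B ** B = mat (trace (B ** B) / 2) ** B + mat (trace (B ** B ** B) / 3)"
proof -
  have B33: "B $ 3 $ 3 = - B $ 1 $ 1 - B $ 2 $ 2"
    using assms by (simp add: trace_def sum_3 eq_neg_iff_add_eq_0 algebra_simps)
  \<comment> \<open>The characteristic polynomial of a traceless \<open>B\<close> is t^3 - s t - det
    B. Here \<open>s\<close> is minus the sum of the principal 2 x 2 minors, with the last diagonal
    entry eliminated; the two trace formulas below are Newton's identities.\<close>
  define s where "s = B$1$1 * B$1$1 + B$1$1 * B$2$2 + B$2$2 * B$2$2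
    + B$1$2 * B$2$1 + B$1$3 * B$3$1 + B$2$3 * B$3$2"
  have "trace (B ** B) = 2 * s"
    by (simp add: s_def matrix_matrix_mult_def trace_def sum_3 B33 algebra_simps)
  moreover have "trace (B ** B ** B) = 3 * det B"
    by (simp add: matrix_matrix_mult_def trace_def sum_3 det_3 B33) algebra
  moreover have "B ** B ** B = mat s ** B + mat (det B)"
    unfolding vec_eq_iff forall_3
    by (simp add: mat_mult_entry)
       (simp add: s_def matrix_matrix_mult_def sum_3 det_3 mat_def B33, intro conjI; algebra)
  ultimately show ?thesis
    by simp
qed

lemma mat_minus: "mat (- c) = (- mat c :: 'a::ring_1^'n^'n)"
  by (simp add: vec_eq_iff mat_def)

text \<open>Multiply the Cayley-Hamilton identity by \<open>M\<close> and take traces; the linear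
  term disappears because \<open>M\<close> is traceless.\<close>

lemma trace_fourth_power_traceless:
  assumes "trace (M::mat3) = 0"
  shows "trace (M ** M ** M ** M) = (trace (M ** M))\<^sup>2 / 2"
proof -
  have "M ** M ** M ** M
      = mat (trace (M ** M) / 2) ** (M ** M) + mat (trace (M ** M ** M) / 3) ** M"
    using arg_cong[OF Cayley_Hamilton_traceless[OF assms], of "\<lambda>N. N ** M"]
    by (simp only: matrix_add_rdistrib matrix_mul_assoc)
  then show ?thesis
    by (simp add: trace_add trace_mat_mult assms power2_eq_square)
qed

text \<open>Polarisation of \<open>Tr (M^4) = Tr (M^2)^2 / 2\<close> at \<open>M = A + B\<close> and \<open>M = A - B\<close>. The difference on
  the right-hand side is the coordinate \<open>v\<close>.\<close>

lemma trace_AABB: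
  assumes "trace (A::mat3) = 0" "trace (B::mat3) = 0"
  shows "trace (A ** A ** B ** B)
    = (trace (A ** A ** B ** B) - trace (A ** B ** A ** B)
        + trace (A ** A) * trace (B ** B) / 2 + (trace (A ** B))\<^sup>2) / 3"
proof -
  have c1: "trace (A ** B ** B ** A) = trace (A ** A ** B ** B)"
    and c2: "trace (B ** B ** A ** A) = trace (A ** A ** B ** B)"
    and c3: "trace (B ** A ** A ** B) = trace (A ** A ** B ** B)"
    and c4: "trace (B ** A ** B ** A) = trace (A ** B ** A ** B)"
    and c5: "trace (B ** A) = trace (A ** B)"
    using trace_mul_sym[of "A ** B ** B" "A"]
      trace_mul_sym[of "B ** B" "A ** A"]
      trace_mul_sym[of "B" "A ** A ** B"]
      trace_mul_sym[of "B" "A ** B ** A"]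
      trace_mul_sym[of "B" "A"]
    by (simp_all add: matrix_mul_assoc)
  define M N where "M = A + B" and "N = A - B"
  have "trace M = 0" "trace N = 0"
    using assms by (auto simp: M_def N_def trace_add trace_sub)
  then have "trace (M ** M ** M ** M) + trace (N ** N ** N ** N)
      = (trace (M ** M))\<^sup>2 / 2 + (trace (N ** N))\<^sup>2 / 2"
    by (simp add: trace_fourth_power_traceless)
  \<comment> \<open>Adding the two expansions cancels the words of odd degree in \<open>B\<close>.
    Of the six words with two letters of each kind, four have the trace of AABB and two have that of
    ABAB, up to cyclic rotation.\<close>
  moreover have "trace (M ** M ** M ** M) + trace (N ** N ** N ** N)
      = 2 * trace (A ** A ** A ** A) + 2 * trace (B ** B ** B ** B)
        + 8 * trace (A ** A ** B ** B) + 4 * trace (A ** B ** A ** B)"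
    unfolding M_def N_def
    by (simp add: matrix_distribs matrix_mul_assoc c1 c2 c3 c4)
  moreover have "trace (M ** M) = trace (A ** A) + 2 * trace (A ** B) + trace (B ** B)"
    and "trace (N ** N) = trace (A ** A) - 2 * trace (A ** B) + trace (B ** B)"
    unfolding M_def N_def by (simp_all add: matrix_distribs c5)
  ultimately show ?thesis
    using trace_fourth_power_traceless[OF assms(1)] trace_fourth_power_traceless[OF assms(2)]
    by (simp add: field_simps power2_eq_square) algebra
qed

text \<open>The four words of the square agree in pairs by cyclicity of the trace. In this form the
  invariance of v needs no expansion, since the commutator itself is invariant.\<close>

lemma trace_commutator_square:
  fixes A B :: mat3
  shows "trace (A ** A ** B ** B) - trace (A ** B ** A ** B)
    = - trace ((A ** B - B ** A) ** (A ** B - B ** A)) / 2"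
proof -
  have c1: "trace (A ** B ** B ** A) = trace (A ** A ** B ** B)"
    and c3: "trace (B ** A ** A ** B) = trace (A ** A ** B ** B)"
    and c4: "trace (B ** A ** B ** A) = trace (A ** B ** A ** B)"
    using trace_mul_sym[of "A ** B ** B" "A"]
      trace_mul_sym[of "B" "A ** A ** B"]
      trace_mul_sym[of "B" "A ** B ** A"]
    by (simp_all add: matrix_mul_assoc)
  show ?thesis
    by (simp add: matrix_distribs matrix_mul_assoc c1 c3 c4)
qed

text \<open>Among the eight words of the cube, the two alternating ones cancel and the other six are
  cyclic rotations of two words, three of each. This serves w as the square serves v.\<close>

lemma trace_commutator_cube:
  fixes A B :: mat3
  shows "trace (A ** A ** B ** B ** A ** B) - trace (A ** A ** B ** A ** B ** B)
    = trace ((A ** B - B ** A) ** (A ** B - B ** A) ** (A ** B - B ** A)) / 3"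
proof -
  have c: "trace (B ** A ** B ** A ** B ** A) = trace (A ** B ** A ** B ** A ** B)"
    "trace (A ** B ** B ** A ** A ** B) = trace (A ** A ** B ** A ** B ** B)"
    "trace (A ** B ** A ** B ** B ** A) = trace (A ** A ** B ** A ** B ** B)"
    "trace (B ** A ** A ** B ** A ** B) = trace (A ** A ** B ** A ** B ** B)"
    "trace (A ** B ** B ** A ** B ** A) = trace (A ** A ** B ** B ** A ** B)"
    "trace (B ** A ** B ** A ** A ** B) = trace (A ** A ** B ** B ** A ** B)"
    "trace (B ** A ** A ** B ** B ** A) = trace (A ** A ** B ** B ** A ** B)"
    using trace_mul_sym[of "B" "A ** B ** A ** B ** A"]
      trace_mul_sym[of "A ** B ** B" "A ** A ** B"]
      trace_mul_sym[of "A ** B ** A ** B ** B" "A"]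
      trace_mul_sym[of "B" "A ** A ** B ** A ** B"]
      trace_mul_sym[of "A ** B ** B ** A ** B" "A"]
      trace_mul_sym[of "B ** A ** B" "A ** A ** B"]
      trace_mul_sym[of "B" "A ** A ** B ** B ** A"]
    by (simp_all add: matrix_mul_assoc)
  show ?thesis
    by (simp add: matrix_distribs matrix_mul_assoc c)
qed

text \<open>The coefficients depend on \<open>Y\<close> only through its characteristic polynomial.\<close>

lemma poly_mat_quadratic:
  "\<exists>c0 c1 c2. \<forall>Y. trace Y = u \<and> trace (traceless Y ** traceless Y) = s
      \<and> trace (traceless Y ** traceless Y ** traceless Y) = t \<longrightarrow>
    poly_mat p Y = mat c0 + mat c1 ** traceless Y + mat c2 ** (traceless Y ** traceless Y)"
proof (induction p)
  case 0
  show ?case by (intro exI[of _ 0]) (simp add: poly_mat_pCons)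
next
  case (pCons a p)
  then obtain c0 c1 c2 where IH: "trace Y = u \<and> trace (traceless Y ** traceless Y) = s
      \<and> trace (traceless Y ** traceless Y ** traceless Y) = t \<Longrightarrow>
    poly_mat p Y = mat c0 + mat c1 ** traceless Y + mat c2 ** (traceless Y ** traceless Y)" for Y
    by blast
  show ?case
  proof (intro exI allI impI)
    fix Y
    assume Y: "trace Y = u \<and> trace (traceless Y ** traceless Y) = s
      \<and> trace (traceless Y ** traceless Y ** traceless Y) = t"
    let ?B = "traceless Y"
    have Y_eq: "Y = ?B + mat (u / 3)"
      using Y by (simp add: traceless_def)
    have comm: "?B ** (mat c ** N) = mat c ** (?B ** N)" for c N
      by (metis mat_mult_commute matrix_mul_assoc)
    \<comment> \<open>Multiplication by \<open>Y\<close> raises the degree in \<open>?B\<close> to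
      three; this brings it back to two with coefficients that involve only \<open>s\<close> and
      \<open>t\<close>.\<close>
    have CH: "?B ** (?B ** ?B) = mat (s / 2) ** ?B + mat (t / 3)"
      using Cayley_Hamilton_traceless[of ?B] Y by (simp add: matrix_mul_assoc)
    have ms: "mat c ** (mat d ** N) = mat (c * d) ** N" for c d and N :: mat3
      by (simp add: matrix_mul_assoc mat_mult_mat)
    have "poly_mat (pCons a p) Y = mat a + (?B + mat (u / 3))
        ** (mat c0 + mat c1 ** ?B + mat c2 ** (?B ** ?B))"
      using IH[OF Y] Y_eq by (simp add: poly_mat_pCons)
    also have "\<dots> = mat (a + u / 3 * c0 + c2 * (t / 3)) + mat (c0 + u / 3 * c1 + c2 * (s / 2)) ** ?B
        + mat (c1 + u / 3 * c2) ** (?B ** ?B)"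
      by (simp only: matrix_add_ldistrib matrix_add_rdistrib comm ms CH mat_mult_mat mat_add
          mat_mult_commute[of _ "?B", symmetric] ac_simps)
    finally show "poly_mat (pCons a p) Y
      = mat (a + u / 3 * c0 + c2 * (t / 3)) + mat (c0 + u / 3 * c1 + c2 * (s / 2)) ** ?B
        + mat (c1 + u / 3 * c2) ** (?B ** ?B)" .
  qed
qed

section \<open>Independence of the action from the representing pair\<close>

lemma trace_poly_mat_cong:
  assumes "coords (X, Y) = coords (X', Y')"
  shows "trace (poly_mat p Y) = trace (poly_mat p Y')"
    and "trace (traceless X ** poly_mat p Y) = trace (traceless X' ** poly_mat p Y')"
    and "trace (traceless X ** traceless X ** poly_mat p Y)
      = trace (traceless X' ** traceless X' ** poly_mat p Y')"
proof -
  let ?A = "traceless X" and ?B = "traceless Y" and ?A' = "traceless X'" and ?B' = "traceless Y'"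
  \<comment> \<open>The coefficients are chosen before the matrix, so the same \<open>c0\<close>,
    \<open>c1\<close>, \<open>c2\<close> serve \<open>Y\<close> and \<open>Y'\<close>, and every
    trace below becomes the same linear combination of traces on both sides.\<close>
  from poly_mat_quadratic[of "trace Y" "trace (?B ** ?B)" "trace (?B ** ?B ** ?B)" p]
  obtain c0 c1 c2 where c: "\<And>Z. trace Z = trace Y \<and> trace (traceless Z ** traceless Z) = trace (?B ** ?B)
      \<and> trace (traceless Z ** traceless Z ** traceless Z) = trace (?B ** ?B ** ?B) \<Longrightarrow>
    poly_mat p Z = mat c0 + mat c1 ** traceless Z + mat c2 ** (traceless Z ** traceless Z)"
    by blast
  have Y: "poly_mat p Y = mat c0 + mat c1 ** ?B + mat c2 ** (?B ** ?B)"
    by (rule c) simp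
  have Y': "poly_mat p Y' = mat c0 + mat c1 ** ?B' + mat c2 ** (?B' ** ?B')"
    by (rule c) (use assms in \<open>simp add: Let_def\<close>)
  have comm: "trace (M ** (mat c ** N)) = c * trace (M ** N)" for c and M N :: mat3
    by (metis mat_mult_commute matrix_mul_assoc trace_mat_mult)
  have comm0: "trace (M ** mat c) = c * trace M" for c and M :: mat3
    by (metis mat_mult_commute trace_mat_mult)
  note tr = matrix_add_ldistrib trace_add trace_mat_mult trace_mat3 comm comm0
  have eqs: "trace (?A ** ?A) = trace (?A' ** ?A')" "trace (?A ** ?B) = trace (?A' ** ?B')"
    "trace (?B ** ?B) = trace (?B' ** ?B')"
    "trace (?A ** ?A ** ?B) = trace (?A' ** ?A' ** ?B')"
    "trace (?A ** ?B ** ?B) = trace (?A' ** ?B' ** ?B')"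
    "trace (?A ** ?A ** ?B ** ?B) - trace (?A ** ?B ** ?A ** ?B)
      = trace (?A' ** ?A' ** ?B' ** ?B') - trace (?A' ** ?B' ** ?A' ** ?B')"
    using assms by (simp_all add: Let_def)
  \<comment> \<open>The only trace that is not itself a coordinate; it is recovered from v and the
    quadratic coordinates.\<close>
  have AABB: "trace (?A ** ?A ** ?B ** ?B) = trace (?A' ** ?A' ** ?B' ** ?B')"
    using eqs trace_AABB[of ?A ?B] trace_AABB[of ?A' ?B'] by simp
  show "trace (?A ** ?A ** poly_mat p Y) = trace (?A' ** ?A' ** poly_mat p Y')"
    unfolding Y Y' by (simp only: tr) (simp add: matrix_mul_assoc eqs AABB)
  show "trace (poly_mat p Y) = trace (poly_mat p Y')"
    unfolding Y Y' by (simp only: tr) (simp add: eqs)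
  show "trace (?A ** poly_mat p Y) = trace (?A' ** poly_mat p Y')"
    unfolding Y Y' by (simp only: tr) (simp add: matrix_mul_assoc eqs)
qed

text \<open>With \<open>q\<close> and \<open>l\<close>, the traceless part of p(Y) and
  \<open>B\<close> are both polynomials in \<open>Y\<close>; they commute, and their products are
  again polynomials in \<open>Y\<close>. Apart from old coordinates, only traces of at most two
  factors \<open>A\<close> and one polynomial in \<open>Y\<close> remain, the shape handled by
  \<open>trace_poly_mat_cong\<close>. The last two entries are kept because the commutator does not
  change.\<close>

lemma coords_Phi_mat:
  fixes X Y p
  defines "A \<equiv> traceless X" and "B \<equiv> traceless Y"
    and "q \<equiv> p - [:trace (poly_mat p Y) / 3:]" and "l \<equiv> [:- trace Y / 3, 1:]"
  shows "coords (Phi_mat p (X, Y)) =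
    (trace X + trace (poly_mat p Y), trace Y,
     trace (A ** A) + 2 * trace (A ** poly_mat q Y) + trace (poly_mat (q * q) Y),
     trace (A ** B) + trace (poly_mat (q * l) Y),
     trace (B ** B),
     trace (A ** A ** A) + 3 * trace (A ** A ** poly_mat q Y) + 3 * trace (A ** poly_mat (q * q) Y)
       + trace (poly_mat (q * q * q) Y),
     trace (A ** A ** B) + 2 * trace (A ** poly_mat (q * l) Y) + trace (poly_mat (q * q * l) Y),
     trace (A ** B ** B) + trace (poly_mat (q * l * l) Y),
     trace (B ** B ** B),
     trace (A ** A ** B ** B) - trace (A ** B ** A ** B),
     trace (A ** A ** B ** B ** A ** B) - trace (A ** A ** B ** A ** B ** B))"
proof -
  define C where "C = poly_mat q Y"
  have l: "poly_mat l Y = B"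
    by (simp add: l_def B_def traceless_def poly_mat_pCons mat_minus)
  have q: "C = poly_mat p Y - mat (trace (poly_mat p Y) / 3)"
  proof -
    have "poly_mat p Y = poly_mat (q + [:trace (poly_mat p Y) / 3:]) Y"
      by (simp add: q_def)
    then show ?thesis
      by (simp add: C_def poly_mat_add poly_mat_const algebra_simps)
  qed
  have A': "traceless (X + poly_mat p Y) = A + C"
    by (simp add: traceless_def A_def q trace_add mat_add add_divide_distrib)
  have BC: "B ** C = C ** B"
    unfolding C_def l[symmetric] by (rule poly_mat_commute)
  have BC': "N ** B ** C = N ** C ** B" for N
    by (metis BC matrix_mul_assoc)
  have K: "(A + C) ** B - B ** (A + C) = A ** B - B ** A"
    by (simp add: matrix_distribs BC)
  have prods: "poly_mat (q * q) Y = C ** C" "poly_mat (q * l) Y = C ** B"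
    "poly_mat (q * q * q) Y = C ** C ** C" "poly_mat (q * q * l) Y = C ** C ** B"
    "poly_mat (q * l * l) Y = C ** B ** B"
    by (simp_all add: poly_mat_mult C_def l)
  have c: "trace (C ** A) = trace (A ** C)" "trace (C ** A ** A) = trace (A ** A ** C)"
    "trace (A ** C ** A) = trace (A ** A ** C)" "trace (C ** A ** C) = trace (A ** C ** C)"
    "trace (C ** C ** A) = trace (A ** C ** C)" "trace (C ** A ** B) = trace (A ** C ** B)"
    using trace_mul_sym[of C A] trace_mul_sym[of C "A ** A"] trace_mul_sym[of "A ** C" A]
      trace_mul_sym[of C "A ** C"] trace_mul_sym[of "C ** C" A] trace_mul_sym[of C "A ** B"]
    by (simp_all add: matrix_mul_assoc BC')
  show ?thesis
    unfolding trace_commutator_square[of A B] trace_commutator_cube[of A B]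
      Phi_mat.simps coords.simps A' B_def[symmetric] Let_def
      trace_commutator_square[of "A + C" B] trace_commutator_cube[of "A + C" B] K prods
    unfolding C_def[symmetric]
    by (simp add: trace_add matrix_add_ldistrib matrix_add_rdistrib matrix_mul_assoc c BC BC')
qed

lemma coords_Phi_mat_cong:
  assumes "coords P = coords P'"
  shows "coords (Phi_mat p P) = coords (Phi_mat p P')"
proof -
  obtain X Y X' Y' where P: "P = (X, Y)" "P' = (X', Y')"
    by (metis surj_pair)
  with assms have "coords (X, Y) = coords (X', Y')"
    by simp
  note tr = trace_poly_mat_cong[OF this]
  have "trace Y = trace Y'"
    using assms by (simp add: P Let_def)
  show ?thesis
    unfolding P coords_Phi_mat tr \<open>trace Y = trace Y'\<close>
    using assms by (simp add: P Let_def)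
qed

text \<open>Transfers results from \<open>Phi_mat\<close> to \<open>Psi_mat\<close>, which are
  conjugate under the swap. Exchanging the matrices negates the commutator, so w, coming from its
  cube, changes sign while v does not.\<close>

lemma coords_swap:
  "coords P = (a1, a2, a3, a4, a5, a6, a7, a8, a9, v, w) \<Longrightarrow>
    coords (prod.swap P) = (a2, a1, a5, a4, a3, a9, a8, a7, a6, v, - w)"
proof (cases P)
  case (Pair X Y)
  let ?A = "traceless X" and ?B = "traceless Y"
  have c: "trace (B ** A) = trace (A ** B)" "trace (B ** B ** A) = trace (A ** B ** B)"
    "trace (B ** A ** A) = trace (A ** A ** B)"
    "trace (B ** B ** A ** A) = trace (A ** A ** B ** B)"
    "trace (B ** A ** B ** A) = trace (A ** B ** A ** B)"
    "trace (B ** B ** A ** A ** B ** A) = trace (A ** A ** B ** A ** B ** B)"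
    "trace (B ** B ** A ** B ** A ** A) = trace (A ** A ** B ** B ** A ** B)" for A B :: mat3
    using trace_mul_sym[of "B" "A"]
      trace_mul_sym[of "B ** B" "A"]
      trace_mul_sym[of "B" "A ** A"]
      trace_mul_sym[of "B ** B" "A ** A"]
      trace_mul_sym[of "B" "A ** B ** A"]
      trace_mul_sym[of "B ** B" "A ** A ** B ** A"]
      trace_mul_sym[of "B ** B ** A ** B" "A ** A"]
    by (simp_all add: matrix_mul_assoc)
  assume "coords P = (a1, a2, a3, a4, a5, a6, a7, a8, a9, v, w)"
  then show ?thesis
    by (auto simp: Pair Let_def c[of ?B ?A])
qed

lemma coords_Psi_mat_cong:
  assumes "coords P = coords P'"
  shows "coords (Psi_mat q P) = coords (Psi_mat q P')"
proof -
  have swap: "coords Q = coords Q' \<Longrightarrow> coords (prod.swap Q) = coords (prod.swap Q')" for Q Q'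
  proof -
    obtain a1 a2 a3 a4 a5 a6 a7 a8 a9 v w
      where "coords Q' = (a1, a2, a3, a4, a5, a6, a7, a8, a9, v, w)"
      by (rule prod_cases7[of "coords Q'"], rule prod_cases5) simp
    then show "coords Q = coords Q' \<Longrightarrow> coords (prod.swap Q) = coords (prod.swap Q')"
      using coords_swap[of Q] coords_swap[of Q'] by simp
  qed
  have Psi: "Psi_mat q Q = prod.swap (Phi_mat q (prod.swap Q))" for Q
    by (cases Q) simp
  show ?thesis
    unfolding Psi by (intro swap coords_Phi_mat_cong assms)
qed

lemma coords_lift_cong:
  assumes "cremona_lift g T" "coords P = coords P'"
  shows "coords (T P) = coords (T P')"
  using assms by induction (auto intro: coords_Phi_mat_cong coords_Psi_mat_cong)

section \<open>Diagonal pairs and evaluation of polynomials\<close>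

definition diagm :: "(3 \<Rightarrow> complex) \<Rightarrow> mat3" where
  "diagm f = (\<chi> i j. if i = j then f i else 0)"

lemma diagm_mult: "diagm f ** diagm g = diagm (\<lambda>i. f i * g i)"
  by (simp add: diagm_def matrix_matrix_mult_def vec_eq_iff if_distrib[of "\<lambda>x. x * _"] cong: if_cong)

lemma diagm_add: "diagm f + diagm g = diagm (\<lambda>i. f i + g i)"
  by (simp add: diagm_def vec_eq_iff)

lemma diagm_minus_mat: "diagm f - mat c = diagm (\<lambda>i. f i - c)"
  by (simp add: diagm_def mat_def vec_eq_iff)

lemma mat_conv_diagm: "mat c = diagm (\<lambda>i. c)"
  by (simp add: diagm_def mat_def)

lemma trace_diagm: "trace (diagm f) = sum f UNIV"
  by (simp add: diagm_def trace_def)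

lemma poly_mat_diagm: "poly_mat p (diagm f) = diagm (\<lambda>i. poly p (f i))"
proof (induction p)
  case 0
  show ?case by (simp add: diagm_def vec_eq_iff)
next
  case (pCons a p)
  then show ?case
    by (simp add: poly_mat_pCons mat_conv_diagm diagm_mult diagm_add)
qed

text \<open>Triples of points are functions on the index type, so that a map of the plane acts on
  them by composition.\<close>

definition diag_pair :: "(3 \<Rightarrow> complex \<times> complex) \<Rightarrow> mat3 \<times> mat3" where
  "diag_pair z = (diagm (\<lambda>i. fst (z i)), diagm (\<lambda>i. snd (z i)))"

lemma coords_diag_pair:
  fixes z :: "3 \<Rightarrow> complex \<times> complex"
  defines "x \<equiv> \<lambda>i. fst (z i) - (\<Sum>j\<in>UNIV. fst (z j)) / 3"
    and "y \<equiv> \<lambda>i. snd (z i) - (\<Sum>j\<in>UNIV. snd (z j)) / 3"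
  shows "coords (diag_pair z) =
    (\<Sum>i\<in>UNIV. fst (z i), \<Sum>i\<in>UNIV. snd (z i),
     \<Sum>i\<in>UNIV. x i * x i, \<Sum>i\<in>UNIV. x i * y i, \<Sum>i\<in>UNIV. y i * y i,
     \<Sum>i\<in>UNIV. x i * x i * x i, \<Sum>i\<in>UNIV. x i * x i * y i,
     \<Sum>i\<in>UNIV. x i * y i * y i, \<Sum>i\<in>UNIV. y i * y i * y i, 0, 0)"
  by (simp add: diag_pair_def traceless_def diagm_minus_mat trace_diagm diagm_mult Let_def
      x_def y_def mult.assoc mult.commute mult.left_commute)

section \<open>Polynomial automorphisms as maps of the plane\<close>

fun phi :: "complex poly \<Rightarrow> complex \<times> complex \<Rightarrow> complex \<times> complex" where
  "phi p (x, y) = (x + poly p y, y)"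

fun psi :: "complex poly \<Rightarrow> complex \<times> complex \<Rightarrow> complex \<times> complex" where
  "psi q (x, y) = (x, y + poly q x)"

lemma Phi_mat_diag_pair: "Phi_mat p (diag_pair z) = diag_pair (phi p \<circ> z)"
proof -
  have "phi p (z i) = (fst (z i) + poly p (snd (z i)), snd (z i))" for i
    by (cases "z i") simp
  then show ?thesis
    by (simp add: diag_pair_def poly_mat_diagm diagm_add)
qed

lemma Psi_mat_diag_pair: "Psi_mat q (diag_pair z) = diag_pair (psi q \<circ> z)"
proof -
  have "psi q (z i) = (fst (z i), snd (z i) + poly q (fst (z i)))" for i
    by (cases "z i") simp
  then show ?thesis
    by (simp add: diag_pair_def poly_mat_diagm diagm_add)
qed

text \<open>The outer variable y is replaced first, by a constant polynomial in x. Evaluation turns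
  substitution into composition with a map of the plane, so identities between automorphisms can be
  checked at points.\<close>

definition ev :: "cxy \<Rightarrow> complex \<times> complex \<Rightarrow> complex" where
  "ev f z = poly (poly f [:snd z:]) (fst z)"

lemma ev_0 [simp]: "ev 0 z = 0"
  and ev_pCons: "ev (pCons a f) z = poly a (fst z) + snd z * ev f z"
  and ev_add: "ev (f + g) z = ev f z + ev g z"
  and ev_mult: "ev (f * g) z = ev f z * ev g z"
  and ev_const_xy: "ev (const_xy c) z = c"
  and ev_var_x: "ev var_x z = fst z"
  and ev_var_y: "ev var_y z = snd z"
  by (simp_all add: ev_def const_xy_def var_x_def var_y_def)

lemma ev_eval_xy: "ev (eval_xy p f) z = poly p (ev f z)"
proof (induction p)
  case (pCons a p)
  have "eval_xy (pCons a p) f = const_xy a + f * eval_xy p f"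
    by (simp add: eval_xy_def map_poly_pCons const_xy_def)
  with pCons show ?case
    by (simp add: ev_add ev_mult ev_const_xy)
qed (simp add: eval_xy_def)

lemma ev_subst_xy: "ev (subst_xy f g h) z = ev h (ev f z, ev g z)"
proof (induction h)
  case (pCons a h)
  have "subst_xy f g (pCons a h) = eval_xy a f + g * subst_xy f g h"
    by (simp add: subst_xy_def map_poly_pCons eval_xy_def)
  with pCons show ?case
    by (simp add: ev_add ev_mult ev_eval_xy ev_pCons)
qed (simp add: subst_xy_def)

lemma ev_Phi: "ev (Phi p f) z = ev f (phi p z)"
  by (cases z) (simp add: Phi_def ev_subst_xy ev_add ev_eval_xy ev_var_x ev_var_y)

lemma ev_Psi: "ev (Psi q f) z = ev f (psi q z)"
  by (cases z) (simp add: Psi_def ev_subst_xy ev_add ev_eval_xy ev_var_x ev_var_y)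

text \<open>A nonzero difference, viewed as a polynomial in y over the ring of polynomials in x,
  would have every constant as a root, which is infinitely many.\<close>

lemma ev_inject:
  assumes "\<And>z. ev f z = ev g z"
  shows "f = g"
proof (rule ccontr)
  assume "f \<noteq> g"
  have "poly (poly f [:y:]) x = poly (poly g [:y:]) x" for x y
    using assms[of "(x, y)"] by (simp add: ev_def)
  then have "poly f [:y:] = poly g [:y:]" for y
    by (metis ext poly_eq_poly_eq_iff)
  then have "range (\<lambda>y. [:y:]) \<subseteq> {a. poly (f - g) a = 0}"
    by auto
  moreover have "finite {a. poly (f - g) a = 0}"
    using \<open>f \<noteq> g\<close> by (intro poly_roots_finite) simp
  moreover have "infinite (range (\<lambda>y::complex. [:y:]))"
    by (simp add: finite_image_iff inj_on_def infinite_UNIV_char_0)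
  ultimately show False
    using finite_subset by blast
qed

lemma phi_phi_minus: "phi p (phi (- p) z) = z" "phi (- p) (phi p z) = z"
  by (cases z; simp)+

lemma psi_psi_minus: "psi q (psi (- q) z) = z" "psi (- q) (psi q z) = z"
  by (cases z; simp)+

lemma Phi_Phi_minus: "Phi p (Phi (- p) f) = f" "Phi (- p) (Phi p f) = f"
  by (rule ev_inject, simp add: ev_Phi phi_phi_minus)+

lemma Psi_Psi_minus: "Psi q (Psi (- q) f) = f" "Psi (- q) (Psi q f) = f"
  by (rule ev_inject, simp add: ev_Psi psi_psi_minus)+

lemma bij_Phi: "bij (Phi p)"
  by (rule o_bij[of "Phi (- p)"]) (simp_all add: fun_eq_iff Phi_Phi_minus)

lemma bij_Psi: "bij (Psi q)"
  by (rule o_bij[of "Psi (- q)"]) (simp_all add: fun_eq_iff Psi_Psi_minus)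

section \<open>The group and its action on diagonal pairs\<close>

lemma mem_Bij_UNIV: "f \<in> Bij UNIV \<longleftrightarrow> bij f"
  by (simp add: Bij_def)

lemma BijGroup_UNIV_mult:
  assumes "bij f" "bij g"
  shows "f \<otimes>\<^bsub>BijGroup UNIV\<^esub> g = f \<circ> g"
  using assms by (simp add: BijGroup_def mem_Bij_UNIV compose_def fun_eq_iff)

lemma BijGroup_UNIV_one: "\<one>\<^bsub>BijGroup UNIV\<^esub> = id"
  by (simp add: BijGroup_def fun_eq_iff)

lemma BijGroup_UNIV_inv:
  assumes "bij f" "bij g" "g \<circ> f = id"
  shows "inv\<^bsub>BijGroup UNIV\<^esub> f = g"
  using assms
  by (intro group.inv_equality[OF group_BijGroup])
     (simp_all add: BijGroup_UNIV_mult BijGroup_UNIV_one, simp_all add: BijGroup_def mem_Bij_UNIV)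

lemma cremona_lift_bij: "cremona_lift g T \<Longrightarrow> bij g"
  by (induction rule: cremona_lift.induct) (simp_all only: bij_id bij_comp bij_Phi bij_Psi)

lemma cremona_lift_comp:
  assumes "cremona_lift h S" "cremona_lift g T"
  shows "cremona_lift (g \<circ> h) (S \<circ> T)"
  using assms
proof (induction rule: cremona_lift.induct)
  case 1
  then show ?case by simp
next
  case (2 h S p)
  then show ?case using cremona_lift.intros(2)[of "g \<circ> h" "S \<circ> T" p] by (simp only: comp_assoc)
next
  case (3 h S q)
  then show ?case using cremona_lift.intros(3)[of "g \<circ> h" "S \<circ> T" q] by (simp only: comp_assoc)
qed

lemma cremona_lift_Phi: "cremona_lift (Phi p) (Phi_mat p)"
  using cremona_lift.intros(2)[OF cremona_lift.intros(1)] by simp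

lemma cremona_lift_Psi: "cremona_lift (Psi q) (Psi_mat q)"
  using cremona_lift.intros(3)[OF cremona_lift.intros(1)] by simp

text \<open>Lifts are built by composition alone, whereas a generated group also contains inverses;
  both give the same set because the inverse of a generator is the generator with the negated
  polynomial.\<close>

lemma carrier_cremona_group: "carrier cremona_group = {g. \<exists>T. cremona_lift g T}"
proof -
  have sub: "range Phi \<union> range Psi \<subseteq> carrier (BijGroup UNIV)"
    by (auto simp: BijGroup_def mem_Bij_UNIV bij_Phi bij_Psi)
  then have "carrier cremona_group = generate (BijGroup UNIV) (range Phi \<union> range Psi)"
    by (simp add: cremona_group_def carrier_subgroup_generated Int_absorb1)
  also have "\<dots> = {g. \<exists>T. cremona_lift g T}"
  proof (intro Set.set_eqI iffI)
    fix g assume "g \<in> generate (BijGroup UNIV) (range Phi \<union> range Psi)"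
    then have "\<exists>T. cremona_lift g T"
    proof induction
      case one
      show ?case unfolding BijGroup_UNIV_one by (blast intro: cremona_lift.intros(1))
    next
      case (incl h)
      then show ?case by (blast intro: cremona_lift_Phi cremona_lift_Psi)
    next
      case (inv h)
      have "inv\<^bsub>BijGroup UNIV\<^esub> (Phi p) = Phi (- p)" for p
        by (rule BijGroup_UNIV_inv) (simp_all add: bij_Phi fun_eq_iff Phi_Phi_minus)
      moreover have "inv\<^bsub>BijGroup UNIV\<^esub> (Psi q) = Psi (- q)" for q
        by (rule BijGroup_UNIV_inv) (simp_all add: bij_Psi fun_eq_iff Psi_Psi_minus)
      ultimately show ?case
        using inv by (metis UnE cremona_lift_Phi cremona_lift_Psi imageE)
    next
      case (eng g h)
      then show ?case
        by (metis BijGroup_UNIV_mult cremona_lift_bij cremona_lift_comp)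
    qed
    then show "g \<in> {g. \<exists>T. cremona_lift g T}"
      by simp
  next
    fix g assume "g \<in> {g. \<exists>T. cremona_lift g T}"
    then obtain T where "cremona_lift g T"
      by blast
    then show "g \<in> generate (BijGroup UNIV) (range Phi \<union> range Psi)"
    proof induction
      case 1
      show ?case unfolding BijGroup_UNIV_one[symmetric] by (rule generate.one)
    next
      case (2 g T p)
      then show ?case
        using generate.eng[OF 2(2) generate.incl[of "Phi p"]]
        by (simp only: BijGroup_UNIV_mult cremona_lift_bij bij_Phi UnI1 UnI2 rangeI)
    next
      case (3 g T q)
      then show ?case
        using generate.eng[OF 3(2) generate.incl[of "Psi q"]]
        by (simp only: BijGroup_UNIV_mult cremona_lift_bij bij_Psi UnI1 UnI2 rangeI)
    qed
  qed
  finally show ?thesis .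
qed

section \<open>Tame maps of the plane and orbits of diagonal pairs\<close>

inductive_set tame :: "(complex \<times> complex \<Rightarrow> complex \<times> complex) set" where
  tame_id: "id \<in> tame"
| tame_phi: "\<tau> \<in> tame \<Longrightarrow> phi p \<circ> \<tau> \<in> tame"
| tame_psi: "\<tau> \<in> tame \<Longrightarrow> psi q \<circ> \<tau> \<in> tame"

lemma tame_generators: "phi p \<in> tame" "psi q \<in> tame"
  using tame_phi[OF tame_id, of p] tame_psi[OF tame_id, of q] by simp_all

lemma tame_comp: "\<sigma> \<in> tame \<Longrightarrow> \<tau> \<in> tame \<Longrightarrow> \<sigma> \<circ> \<tau> \<in> tame"
  by (induction rule: tame.induct) (simp_all only: id_comp comp_assoc tame.intros)

lemma tame_inverse: "\<tau> \<in> tame \<Longrightarrow> \<exists>\<sigma>\<in>tame. \<sigma> \<circ> \<tau> = id"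
proof (induction rule: tame.induct)
  case tame_id
  then show ?case using tame.tame_id by (intro bexI[of _ id]) auto
next
  case (tame_phi \<tau> p)
  then obtain \<sigma> where s: "\<sigma> \<in> tame" "\<sigma> \<circ> \<tau> = id"
    by blast
  have "(\<sigma> \<circ> phi (- p)) \<circ> (phi p \<circ> \<tau>) = \<sigma> \<circ> \<tau>"
    by (simp add: fun_eq_iff phi_phi_minus)
  then show ?case
    using s by (intro bexI[of _ "\<sigma> \<circ> phi (- p)"]) (simp_all only: tame_comp tame_generators)
next
  case (tame_psi \<tau> q)
  then obtain \<sigma> where s: "\<sigma> \<in> tame" "\<sigma> \<circ> \<tau> = id"
    by blast
  have "(\<sigma> \<circ> psi (- q)) \<circ> (psi q \<circ> \<tau>) = \<sigma> \<circ> \<tau>"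
    by (simp add: fun_eq_iff psi_psi_minus)
  then show ?case
    using s by (intro bexI[of _ "\<sigma> \<circ> psi (- q)"]) (simp_all only: tame_comp tame_generators)
qed

text \<open>The map of the plane is written through the images of the two variables under
  \<open>g\<close>, which makes visible that on diagonal pairs \<open>T\<close> depends on
  \<open>g\<close> alone and not on the chosen word in the generators.\<close>

lemma cremona_lift_diag_pair:
  assumes "cremona_lift g T"
  shows "(\<lambda>z. (ev (g var_x) z, ev (g var_y) z)) \<in> tame"
    and "T (diag_pair z) = diag_pair ((\<lambda>z. (ev (g var_x) z, ev (g var_y) z)) \<circ> z)"
proof -
  have "\<exists>\<tau>\<in>tame. (\<forall>f z. ev (g f) z = ev f (\<tau> z)) \<and> (\<forall>z. T (diag_pair z) = diag_pair (\<tau> \<circ> z))"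
    using assms
  proof induction
    case 1
    show ?case by (intro bexI[of _ id] tame_id) simp
  next
    case (2 g T p)
    then obtain \<tau> where "\<tau> \<in> tame" "\<And>f z. ev (g f) z = ev f (\<tau> z)"
      "\<And>z. T (diag_pair z) = diag_pair (\<tau> \<circ> z)"
      by blast
    moreover from this have "(Phi_mat p \<circ> T) (diag_pair z) = diag_pair (phi p \<circ> \<tau> \<circ> z)" for z
      by (simp add: Phi_mat_diag_pair o_def)
    ultimately show ?case
      by (intro bexI[of _ "phi p \<circ> \<tau>"] conjI allI tame_phi) (simp_all add: ev_Phi o_def)
  next
    case (3 g T q)
    then obtain \<tau> where "\<tau> \<in> tame" "\<And>f z. ev (g f) z = ev f (\<tau> z)"
      "\<And>z. T (diag_pair z) = diag_pair (\<tau> \<circ> z)"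
      by blast
    moreover from this have "(Psi_mat q \<circ> T) (diag_pair z) = diag_pair (psi q \<circ> \<tau> \<circ> z)" for z
      by (simp add: Psi_mat_diag_pair o_def)
    ultimately show ?case
      by (intro bexI[of _ "psi q \<circ> \<tau>"] conjI allI tame_psi) (simp_all add: ev_Psi o_def)
  qed
  then obtain \<tau> where t: "\<tau> \<in> tame" "\<And>f z. ev (g f) z = ev f (\<tau> z)"
    "\<And>z. T (diag_pair z) = diag_pair (\<tau> \<circ> z)"
    by blast
  have "(\<lambda>z. (ev (g var_x) z, ev (g var_y) z)) = \<tau>"
    by (simp add: t(2) ev_var_x ev_var_y)
  with t show "(\<lambda>z. (ev (g var_x) z, ev (g var_y) z)) \<in> tame"
    and "T (diag_pair z) = diag_pair ((\<lambda>z. (ev (g var_x) z, ev (g var_y) z)) \<circ> z)"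
    by simp_all
qed

text \<open>Justifies the definite description at points coming from diagonal pairs. The
  representing pair can be exchanged for the diagonal one by \<open>coords_lift_cong\<close>, and
  there all lifts of \<open>g\<close> agree. By \<open>C30_diag_pair\<close> this covers all of
  \<open>C30\<close>.\<close>

lemma cremona_action_diag_pair:
  assumes "cremona_lift g T"
  shows "cremona_action g (coords (diag_pair z)) = coords (T (diag_pair z))"
  unfolding cremona_action_def
proof (rule the_equality)
  show "\<exists>T' P. cremona_lift g T' \<and> coords P = coords (diag_pair z) \<and> coords (T' P) = coords (T (diag_pair z))"
    using assms by blast
next
  fix d
  assume "\<exists>T' P. cremona_lift g T' \<and> coords P = coords (diag_pair z) \<and> coords (T' P) = d"
  then obtain T' P where T': "cremona_lift g T'" and P: "coords P = coords (diag_pair z)"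
    and d: "coords (T' P) = d"
    by blast
  have "d = coords (T' (diag_pair z))"
    using coords_lift_cong[OF T' P] d by simp
  also have "\<dots> = coords (T (diag_pair z))"
    by (simp add: cremona_lift_diag_pair(2)[OF T'] cremona_lift_diag_pair(2)[OF assms])
  finally show "d = coords (T (diag_pair z))" .
qed

lemma tame_lift: "\<tau> \<in> tame \<Longrightarrow> \<exists>g T. cremona_lift g T \<and> (\<forall>z. T (diag_pair z) = diag_pair (\<tau> \<circ> z))"
proof (induction rule: tame.induct)
  case tame_id
  then show ?case by (metis cremona_lift.intros(1) id_apply id_comp)
next
  case (tame_phi \<tau> p)
  then show ?case
    by (metis Phi_mat_diag_pair comp_apply comp_assoc cremona_lift.intros(2))
next
  case (tame_psi \<tau> q)
  then show ?case
    by (metis Psi_mat_diag_pair comp_apply comp_assoc cremona_lift.intros(3))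
qed

lemma orbit_diag_pair:
  "orbit cremona_group cremona_action (coords (diag_pair z)) = (\<lambda>\<tau>. coords (diag_pair (\<tau> \<circ> z))) ` tame"
proof (intro Set.set_eqI iffI)
  fix c assume "c \<in> orbit cremona_group cremona_action (coords (diag_pair z))"
  then obtain g T where "cremona_lift g T" "c = cremona_action g (coords (diag_pair z))"
    by (auto simp: orbit_def carrier_cremona_group)
  then show "c \<in> (\<lambda>\<tau>. coords (diag_pair (\<tau> \<circ> z))) ` tame"
    using cremona_lift_diag_pair[of g T] by (auto simp: cremona_action_diag_pair)
next
  fix c assume "c \<in> (\<lambda>\<tau>. coords (diag_pair (\<tau> \<circ> z))) ` tame"
  then obtain \<tau> where t: "\<tau> \<in> tame" "c = coords (diag_pair (\<tau> \<circ> z))"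
    by blast
  obtain g T where "cremona_lift g T" "\<forall>z. T (diag_pair z) = diag_pair (\<tau> \<circ> z)"
    using tame_lift[OF t(1)] by blast
  then show "c \<in> orbit cremona_group cremona_action (coords (diag_pair z))"
    unfolding orbit_def carrier_cremona_group
    using t(2) cremona_action_diag_pair[of g T z] by (intro CollectI exI[of _ g]) auto
qed

text \<open>Closure of \<open>tame\<close> under composition gives one inclusion; the same inclusion
  for a left inverse of \<open>\<tau>\<close> gives the other.\<close>

lemma orbit_diag_pair_eq:
  assumes "\<tau> \<in> tame"
  shows "orbit cremona_group cremona_action (coords (diag_pair (\<tau> \<circ> z)))
    = orbit cremona_group cremona_action (coords (diag_pair z))"
proof -
  have sub: "orbit cremona_group cremona_action (coords (diag_pair (\<sigma> \<circ> w)))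
    \<subseteq> orbit cremona_group cremona_action (coords (diag_pair w))" if "\<sigma> \<in> tame" for \<sigma> w
    using that tame_comp by (force simp: orbit_diag_pair comp_assoc[symmetric])
  obtain \<sigma> where "\<sigma> \<in> tame" "\<sigma> \<circ> \<tau> = id"
    using tame_inverse[OF assms] by blast
  then show ?thesis
    using sub[OF assms, of z] sub[of \<sigma> "\<tau> \<circ> z"] by (simp add: comp_assoc[symmetric])
qed

section \<open>Transitivity on triples of points\<close>

lemma finite_interpolation:
  fixes f :: "'a::field \<Rightarrow> 'a"
  assumes "finite S"
  shows "\<exists>p. \<forall>a\<in>S. poly p a = f a"
  using assms
proof (induction S rule: finite_induct)
  case (insert b S)
  then obtain p where p: "\<forall>a\<in>S. poly p a = f a"
    by blast
  \<comment> \<open>Newton's form of interpolation: a multiple of \<open>?R\<close> corrects the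
    value at \<open>b\<close> without disturbing the values on \<open>S\<close>.\<close>
  let ?R = "\<Prod>a\<in>S. [:- a, 1:]"
  have "poly ?R b \<noteq> 0" "\<forall>a\<in>S. poly ?R a = 0"
    using insert by (auto simp: poly_prod)
  with p show ?case
    by (intro exI[of _ "p + smult ((f b - poly p b) / poly ?R b) ?R"]) auto
qed simp

lemma interpolation_on_family:
  fixes y t :: "'i::finite \<Rightarrow> 'a::field"
  assumes "\<And>i j. y i = y j \<Longrightarrow> t i = t j"
  shows "\<exists>p. \<forall>i. poly p (y i) = t i"
proof -
  \<comment> \<open>The choice picks an index for each value of \<open>y\<close>; by the assumption
    the prescribed value does not depend on it.\<close>
  obtain p where p: "\<forall>a\<in>range y. poly p a = t (SOME i. y i = a)"
    using finite_interpolation[of "range y" "\<lambda>a. t (SOME i. y i = a)"] by auto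
  have "t (SOME j. y j = y i) = t i" for i
    by (rule assms) (rule someI, rule refl)
  with p show ?thesis
    by (intro exI[of _ p]) simp
qed

text \<open>Two distinct points are merged for at most one value of \<open>c\<close>, and there are
  only finitely many pairs of indices.\<close>

lemma separating_shear:
  fixes z :: "'i::finite \<Rightarrow> complex \<times> complex"
  shows "\<exists>c. \<forall>i j. snd (z i) + c * fst (z i) = snd (z j) + c * fst (z j) \<longrightarrow> z i = z j"
proof -
  \<comment> \<open>Pairs with equal first coordinates contribute 0, the value of division by zero,
    so one more value of \<open>c\<close> is excluded, which does no harm.\<close>
  let ?bad = "(\<lambda>(i, j). (snd (z j) - snd (z i)) / (fst (z i) - fst (z j))) ` UNIV"
  have "infinite (UNIV :: complex set)"
    by (rule infinite_UNIV_char_0)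
  then obtain c where c: "c \<notin> ?bad"
    using ex_new_if_finite[of ?bad] by auto
  have "z i = z j" if "snd (z i) + c * fst (z i) = snd (z j) + c * fst (z j)" for i j
  proof (cases "fst (z i) = fst (z j)")
    case True
    with that show ?thesis by (simp add: prod_eq_iff)
  next
    case False
    with that have "c = (snd (z j) - snd (z i)) / (fst (z i) - fst (z j))"
      by (simp add: field_simps)
    with c show ?thesis by auto
  qed
  then show ?thesis by blast
qed

text \<open>Four elementary maps move the points as follows: (x, y) to (x, y + c x) to (e, y + c x)
  to (e, e) to (0, e). The interpolation for \<open>p\<close> is consistent because the shear
  separates distinct points and equal points have equal \<open>e\<close>; the one for
  \<open>q\<close> because equal \<open>e\<close> forces equal points.\<close>

lemma tame_transitive:
  fixes z :: "3 \<Rightarrow> complex \<times> complex" and e :: "3 \<Rightarrow> complex"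
  assumes "\<And>i j. z i = z j \<longleftrightarrow> e i = e j"
  shows "\<exists>\<tau>\<in>tame. \<tau> \<circ> z = (\<lambda>i. (0, e i))"
proof -
  define x y where "x i = fst (z i)" and "y i = snd (z i)" for i
  obtain c where c: "\<And>i j. y i + c * x i = y j + c * x j \<Longrightarrow> z i = z j"
    using separating_shear[of z] unfolding x_def y_def by blast
  obtain p where p: "\<And>i. poly p (y i + c * x i) = e i - x i"
    using interpolation_on_family[of "\<lambda>i. y i + c * x i" "\<lambda>i. e i - x i"] c assms
    unfolding x_def by metis
  obtain q where q: "\<And>i. poly q (e i) = e i - (y i + c * x i)"
    using interpolation_on_family[of e "\<lambda>i. e i - (y i + c * x i)"] assms
    unfolding x_def y_def by metis
  define \<tau> where "\<tau> = phi [:0, -1:] \<circ> (psi q \<circ> (phi p \<circ> psi [:0, c:]))"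
  have "z i = (x i, y i)" for i
    by (simp add: x_def y_def)
  then have "\<tau> (z i) = (0, e i)" for i
    by (simp add: \<tau>_def p q mult.commute[of _ c])
  moreover have "\<tau> \<in> tame"
    unfolding \<tau>_def by (intro tame_comp tame_generators)
  ultimately show ?thesis
    by (intro bexI[of _ \<tau>]) auto
qed

section \<open>Points as power sums\<close>

lemma coords_centred:
  assumes "x1 + x2 + x3 = 0" "y1 + y2 + y3 = 0"
  shows "\<exists>z. coords (diag_pair z) = (a1, a2,
    x1 * x1 + x2 * x2 + x3 * x3, x1 * y1 + x2 * y2 + x3 * y3, y1 * y1 + y2 * y2 + y3 * y3,
    x1 * x1 * x1 + x2 * x2 * x2 + x3 * x3 * x3, x1 * x1 * y1 + x2 * x2 * y2 + x3 * x3 * y3,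
    x1 * y1 * y1 + x2 * y2 * y2 + x3 * y3 * y3, y1 * y1 * y1 + y2 * y2 * y2 + y3 * y3 * y3, 0, 0)"
proof -
  \<comment> \<open>Translating the centred points by a third of the prescribed traces restores
    \<open>a1\<close> and \<open>a2\<close> and keeps the centred power sums.\<close>
  define z :: "3 \<Rightarrow> complex \<times> complex" where
    "z i = (if i = 1 then (x1 + a1 / 3, y1 + a2 / 3) else if i = 2 then (x2 + a1 / 3, y2 + a2 / 3)
      else (x3 + a1 / 3, y3 + a2 / 3))" for i
  have z: "z 1 = (x1 + a1 / 3, y1 + a2 / 3)" "z 2 = (x2 + a1 / 3, y2 + a2 / 3)"
    "z 3 = (x3 + a1 / 3, y3 + a2 / 3)"
    by (simp_all add: z_def)
  have s: "(x1 + a1 / 3) + (x2 + a1 / 3) + (x3 + a1 / 3) = a1"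
    "(y1 + a2 / 3) + (y2 + a2 / 3) + (y3 + a2 / 3) = a2"
    using assms by (simp_all add: field_simps) algebra+
  show ?thesis
    by (rule exI[of _ z]) (simp only: coords_diag_pair sum_3 z fst_conv snd_conv s add_diff_cancel_right')
qed

lemma coords_vertical:
  assumes "(\<Sum>i\<in>UNIV. e i) = 0"
  shows "coords (diag_pair (\<lambda>i. (0, e i)))
    = (0, 0, 0, 0, \<Sum>i\<in>UNIV. e i * e i, 0, 0, 0, \<Sum>i\<in>UNIV. e i * e i * e i, 0, 0)"
  by (simp only: coords_diag_pair fst_conv snd_conv assms) simp

lemma quadratic_sum_prod:
  fixes s p :: complex
  obtains x y where "x + y = s" "x * y = p"
proof
  let ?d = "csqrt (s\<^sup>2 - 4 * p)"
  show "(s + ?d) / 2 + (s - ?d) / 2 = s"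
    by (simp add: field_simps)
  have "?d\<^sup>2 = s\<^sup>2 - 4 * p"
    by (rule power2_csqrt)
  then show "(s + ?d) / 2 * ((s - ?d) / 2) = p"
    by (simp add: power2_eq_square algebra_simps)
qed

text \<open>By Newton's identities the three numbers are the roots of t^3 - (s/2) t - c/3. One root
  comes from the fundamental theorem of algebra; Vieta's formulas then prescribe the sum and the
  product of the other two.\<close>

lemma cubic_power_sums:
  fixes s c :: complex
  obtains y1 y2 y3 where "y1 + y2 + y3 = 0" "y1 * y1 + y2 * y2 + y3 * y3 = s"
    "y1 * y1 * y1 + y2 * y2 * y2 + y3 * y3 * y3 = c"
proof -
  have "\<not> constant (poly [:- c / 3, - s / 2, 0, 1:])"
    by (simp add: constant_degree)
  then obtain y1 where "poly [:- c / 3, - s / 2, 0, 1:] y1 = 0"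
    using fundamental_theorem_of_algebra by blast
  then have y1: "6 * (y1 * y1 * y1) = 3 * s * y1 + 2 * c"
    by (simp add: field_simps)
  obtain y2 y3 where y: "y2 + y3 = - y1" "y2 * y3 = y1 * y1 - s / 2"
    by (rule quadratic_sum_prod)
  have "2 * (y2 * y3) = 2 * (y1 * y1) - s"
    using y(2) by (simp add: field_simps)
  with y(1) y1 show ?thesis
    by (intro that[of y1 y2 y3]) algebra+
qed

text \<open>The second coordinates are dictated by \<open>a5\<close> and \<open>a9\<close>, being
  roots of a cubic. The cases are: three distinct roots, all roots zero, and a nonzero double
  root.\<close>

lemma C30_power_sums:
  fixes a3 a4 a5 a6 a7 a8 a9 :: complex
  assumes e1: "a3 * a9 - 2 * a4 * a8 + a5 * a7 = 0"
    and e2: "a5 * a6 - 2 * a4 * a7 + a3 * a8 = 0"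
    and e3: "a3^2 * a5 - a3 * a4^2 + 6 * a6 * a8 - 6 * a7^2 = 0"
    and e4: "a3 * a4 * a5 - a4^3 + 3 * a6 * a9 - 3 * a7 * a8 = 0"
    and e5: "a3 * a5^2 - a4^2 * a5 + 6 * a7 * a9 - 6 * a8^2 = 0"
  shows "\<exists>x1 x2 x3 y1 y2 y3. x1 + x2 + x3 = 0 \<and> y1 + y2 + y3 = 0 \<and>
    x1 * x1 + x2 * x2 + x3 * x3 = a3 \<and> x1 * y1 + x2 * y2 + x3 * y3 = a4 \<and>
    y1 * y1 + y2 * y2 + y3 * y3 = a5 \<and>
    x1 * x1 * x1 + x2 * x2 * x2 + x3 * x3 * x3 = a6 \<and>
    x1 * x1 * y1 + x2 * x2 * y2 + x3 * x3 * y3 = a7 \<and>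
    x1 * y1 * y1 + x2 * y2 * y2 + x3 * y3 * y3 = a8 \<and>
    y1 * y1 * y1 + y2 * y2 * y2 + y3 * y3 * y3 = a9"
proof (cases "a5 ^ 3 = 6 * a9 ^ 2")
  case False
  \<comment> \<open>\<open>D\<close> is twice the discriminant of the cubic with the roots \<open>y1\<close>, \<open>y2\<close>, \<open>y3\<close>; as it is nonzero,
    \<open>x\<close> can be found as a quadratic polynomial in \<open>y\<close> with the prescribed \<open>a4\<close> and \<open>a8\<close>. The first,
    second, fourth and fifth equations then determine \<open>a3\<close>, \<open>a7\<close> and \<open>a6\<close>.\<close>
  define D where "D = a5 ^ 3 - 6 * a9 ^ 2"
  have D: "D \<noteq> 0"
    using False by (simp add: D_def)
  obtain y1 y2 y3 where y: "y1 + y2 + y3 = 0" "y1 * y1 + y2 * y2 + y3 * y3 = a5"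
    "y1 * y1 * y1 + y2 * y2 * y2 + y3 * y3 * y3 = a9"
    by (rule cubic_power_sums)
  have y3: "y3 = - y1 - y2"
    using y(1) by algebra
  \<comment> \<open>The fourth power sum of a centred triple is half the square of the second; it is
    needed since x times y^2 has degree four in y.\<close>
  have p4: "2 * (y1 * y1 * y1 * y1 + y2 * y2 * y2 * y2 + y3 * y3 * y3 * y3) = a5 * a5"
    unfolding y(2)[symmetric] y3 by algebra
  \<comment> \<open>Cramer's rule for the two equations of \<open>bg\<close>, a linear system of
    determinant \<open>D\<close>. They state that the constructed points have the prescribed
    \<open>a4\<close> and \<open>a8\<close>.\<close>
  define \<beta> \<gamma> where "\<beta> = (a4 * a5^2 - 6 * a8 * a9) / D" and "\<gamma> = 6 * (a5 * a8 - a9 * a4) / D"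
  have bg: "\<beta> * a5 + \<gamma> * a9 = a4" "6 * (\<beta> * a9) + \<gamma> * (a5 * a5) = 6 * a8"
  proof -
    have "D * \<beta> = a4 * a5^2 - 6 * a8 * a9" "D * \<gamma> = 6 * (a5 * a8 - a9 * a4)"
      using D by (simp_all add: \<beta>_def \<gamma>_def)
    moreover have "D * (\<beta> * a5 + \<gamma> * a9) = (D * \<beta>) * a5 + (D * \<gamma>) * a9"
      "D * (6 * (\<beta> * a9) + \<gamma> * (a5 * a5)) = 6 * ((D * \<beta>) * a9) + (D * \<gamma>) * (a5 * a5)"
      by algebra+
    moreover have "(a4 * a5^2 - 6 * a8 * a9) * a5 + 6 * (a5 * a8 - a9 * a4) * a9 = D * a4"
      "6 * ((a4 * a5^2 - 6 * a8 * a9) * a9) + 6 * (a5 * a8 - a9 * a4) * (a5 * a5) = D * (6 * a8)"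
      unfolding D_def by algebra+
    ultimately have "D * (\<beta> * a5 + \<gamma> * a9) = D * a4"
      "D * (6 * (\<beta> * a9) + \<gamma> * (a5 * a5)) = D * (6 * a8)"
      by (simp_all only:)
    then show "\<beta> * a5 + \<gamma> * a9 = a4" "6 * (\<beta> * a9) + \<gamma> * (a5 * a5) = 6 * a8"
      using D by simp_all
  qed
  \<comment> \<open>The constant term is chosen to centre the first coordinates.\<close>
  define \<alpha> where "\<alpha> = - \<gamma> * a5 / 3"
  have al: "3 * \<alpha> + \<gamma> * a5 = 0"
    by (simp add: \<alpha>_def)
  define x1 x2 x3 where "x1 = \<alpha> + \<beta> * y1 + \<gamma> * (y1 * y1)" and "x2 = \<alpha> + \<beta> * y2 + \<gamma> * (y2 * y2)"
    and "x3 = \<alpha> + \<beta> * y3 + \<gamma> * (y3 * y3)"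
  have sx: "x1 + x2 + x3 = 0"
  proof -
    have "x1 + x2 + x3 = 3 * \<alpha> + \<beta> * (y1 + y2 + y3) + \<gamma> * (y1 * y1 + y2 * y2 + y3 * y3)"
      unfolding x1_def x2_def x3_def by algebra
    then show ?thesis using al y by simp
  qed
  have sxy: "x1 * y1 + x2 * y2 + x3 * y3 = a4"
  proof -
    have "x1 * y1 + x2 * y2 + x3 * y3 = \<alpha> * (y1 + y2 + y3) + \<beta> * (y1 * y1 + y2 * y2 + y3 * y3)
      + \<gamma> * (y1 * y1 * y1 + y2 * y2 * y2 + y3 * y3 * y3)"
      unfolding x1_def x2_def x3_def by algebra
    then show ?thesis using bg(1) y by simp
  qed
  have sxyy: "x1 * y1 * y1 + x2 * y2 * y2 + x3 * y3 * y3 = a8"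
  proof -
    have "6 * (x1 * y1 * y1 + x2 * y2 * y2 + x3 * y3 * y3) = 6 * \<alpha> * (y1 * y1 + y2 * y2 + y3 * y3)
      + 6 * \<beta> * (y1 * y1 * y1 + y2 * y2 * y2 + y3 * y3 * y3)
      + 3 * \<gamma> * (2 * (y1 * y1 * y1 * y1 + y2 * y2 * y2 * y2 + y3 * y3 * y3 * y3))"
      unfolding x1_def x2_def x3_def by algebra
    also have "\<dots> = 2 * (3 * \<alpha> + \<gamma> * a5) * a5 + (6 * (\<beta> * a9) + \<gamma> * (a5 * a5))"
      unfolding y p4 by algebra
    also have "\<dots> = 6 * a8"
      unfolding al bg(2) by simp
    finally show ?thesis by (simp only: mult_cancel_left) simp
  qed
  \<comment> \<open>The remaining power sums of the constructed points. They satisfy the same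
    relations as \<open>a3\<close>, \<open>a6\<close>, \<open>a7\<close>, and the comparison uses
    only that these relations are linear in the unknowns.\<close>
  define b3 b6 b7 where "b3 = x1 * x1 + x2 * x2 + x3 * x3"
    and "b6 = x1 * x1 * x1 + x2 * x2 * x2 + x3 * x3 * x3"
    and "b7 = x1 * x1 * y1 + x2 * x2 * y2 + x3 * x3 * y3"
  have x3: "x3 = - x1 - x2"
    using sx by algebra
  note defs = b3_def b6_def b7_def sxy[symmetric] sxyy[symmetric] y(2)[symmetric] y(3)[symmetric] x3 y3
  have f1: "b3 * a9 - 2 * a4 * a8 + a5 * b7 = 0"
    unfolding defs by algebra
  have f2: "a5 * b6 - 2 * a4 * b7 + b3 * a8 = 0"
    unfolding defs by algebra
  have f4: "b3 * a4 * a5 - a4^3 + 3 * b6 * a9 - 3 * b7 * a8 = 0"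
    unfolding defs by algebra
  have f5: "b3 * a5^2 - a4^2 * a5 + 6 * b7 * a9 - 6 * a8^2 = 0"
    unfolding defs by algebra
  \<comment> \<open>Elimination in the first and fifth relations, a linear system for the
    differences with determinant \<open>D\<close> up to sign.\<close>
  have "D * (b3 - a3) = a5 * ((b3 * a5^2 - a4^2 * a5 + 6 * b7 * a9 - 6 * a8^2)
      - (a3 * a5^2 - a4^2 * a5 + 6 * a7 * a9 - 6 * a8^2))
      - 6 * a9 * ((b3 * a9 - 2 * a4 * a8 + a5 * b7) - (a3 * a9 - 2 * a4 * a8 + a5 * a7))"
    "D * (b7 - a7) = a5^2 * ((b3 * a9 - 2 * a4 * a8 + a5 * b7) - (a3 * a9 - 2 * a4 * a8 + a5 * a7))
      - a9 * ((b3 * a5^2 - a4^2 * a5 + 6 * b7 * a9 - 6 * a8^2)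
      - (a3 * a5^2 - a4^2 * a5 + 6 * a7 * a9 - 6 * a8^2))"
    unfolding D_def by algebra+
  with D have b37: "b3 = a3" "b7 = a7"
    unfolding e1 e5 f1 f5 by simp_all
  \<comment> \<open>The second relation determines the sixth coordinate when \<open>a5\<close> is
    nonzero, the fourth when \<open>a9\<close> is; both cannot vanish as \<open>D\<close> is
    nonzero.\<close>
  have "a5 * b6 = a5 * a6" "a9 * b6 = a9 * a6"
    using e2 e4 f2 f4 unfolding b37 by algebra+
  moreover have "a5 \<noteq> 0 \<or> a9 \<noteq> 0"
    using False by auto
  ultimately have "b6 = a6"
    by auto
  with b37 sx y sxy sxyy show ?thesis
    unfolding b3_def b6_def b7_def by blast
next
  case True
  show ?thesis
  proof (cases "a5 = 0")
    \<comment> \<open>All second coordinates are taken to be zero. The fifth, fourth and third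
      equations successively kill \<open>a8\<close>, \<open>a4\<close> and \<open>a7\<close>, and
      only \<open>a3\<close> and \<open>a6\<close> remain to be matched.\<close>
    case True
    with \<open>a5 ^ 3 = 6 * a9 ^ 2\<close> have "a9 = 0"
      by simp
    moreover from this True e5 have "a8 = 0"
      by simp
    moreover from this calculation True e4 have "a4 = 0"
      by simp
    moreover from this calculation True e3 have "a7 = 0"
      by simp
    moreover obtain x1 x2 x3 where "x1 + x2 + x3 = 0" "x1 * x1 + x2 * x2 + x3 * x3 = a3"
      "x1 * x1 * x1 + x2 * x2 * x2 + x3 * x3 * x3 = a6"
      by (rule cubic_power_sums)
    ultimately show ?thesis
      using True by (intro exI[of _ x1] exI[of _ x2] exI[of _ x3] exI[of _ 0]) simp
  next
    case False
    \<comment> \<open>The cubic has the roots \<open>y\<close>, \<open>y\<close>, \<open>- 2 * y\<close>.\<close>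
    define y where "y = - a9 / a5"
    have "a5 * y = - a9"
      using False by (simp add: y_def)
    moreover from this True have "a5 ^ 2 * a5 = a5 ^ 2 * (6 * y ^ 2)"
      by algebra
    ultimately have a5: "a5 = 6 * y ^ 2"
      using False by simp
    with \<open>a5 * y = - a9\<close> have a9: "a9 = - 6 * y ^ 3"
      by algebra
    have y: "y \<noteq> 0"
      using False a5 by auto
    \<comment> \<open>At a double root this combination of the fifth and first equations is a
      perfect square up to a factor, which fixes \<open>a8\<close>.\<close>
    have "- 6 * (y * a4 + a8) ^ 2 = (a3 * a5^2 - a4^2 * a5 + 6 * a7 * a9 - 6 * a8^2)
      + 6 * y * (a3 * a9 - 2 * a4 * a8 + a5 * a7)"
      unfolding a5 a9 by algebra
    then have "(y * a4 + a8) ^ 2 = 0"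
      unfolding e1 e5 by simp
    then have a8: "a8 = - y * a4"
      by (simp add: eq_neg_iff_add_eq_0 add.commute)
    \<comment> \<open>In a centred triple \<open>a4\<close> is (x1 + x2) y - 2 x3 y = - 3 y x3, so
      it determines \<open>x3\<close>. The other two are then found from their sum and from
      \<open>a3\<close>; the first and second equations yield \<open>a7\<close> and
      \<open>a6\<close>.\<close>
    define x3 where "x3 = - a4 / (3 * y)"
    have a4: "a4 = - 3 * y * x3"
      using y by (simp add: x3_def)
    obtain x1 x2 where x: "x1 + x2 = - x3" "x1 * x2 = x3 * x3 - a3 / 2"
      by (rule quadratic_sum_prod)
    have "2 * (x1 * x2) = 2 * (x3 * x3) - a3"
      using x(2) by (simp add: field_simps)
    moreover have x1: "x1 = - x3 - x2"
      using x(1) by algebra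
    ultimately have a3: "a3 = x1 * x1 + x2 * x2 + x3 * x3"
      by algebra
    have "6 * y ^ 2 * (a7 - y * (a3 - 3 * x3 ^ 2)) = a3 * a9 - 2 * a4 * a8 + a5 * a7"
      unfolding a5 a9 a8 a4 by algebra
    with y e1 have a7: "a7 = y * (a3 - 3 * x3 ^ 2)"
      by simp
    have "a5 * (a6 - (x1 * x1 * x1 + x2 * x2 * x2 + x3 * x3 * x3)) = a5 * a6 - 2 * a4 * a7 + a3 * a8"
      unfolding a5 a7 a8 a4 a3 x1 by algebra
    with False e2 have a6: "x1 * x1 * x1 + x2 * x2 * x2 + x3 * x3 * x3 = a6"
      by simp
    have "x1 + x2 + x3 = 0" "y + y + (- 2 * y) = 0"
      "x1 * y + x2 * y + x3 * (- 2 * y) = a4"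
      "y * y + y * y + (- 2 * y) * (- 2 * y) = a5"
      "x1 * x1 * y + x2 * x2 * y + x3 * x3 * (- 2 * y) = a7"
      "x1 * y * y + x2 * y * y + x3 * (- 2 * y) * (- 2 * y) = a8"
      "y * y * y + y * y * y + (- 2 * y) * (- 2 * y) * (- 2 * y) = a9"
      unfolding a5 a9 a8 a4 a7 a3 x1 by algebra+
    with a3[symmetric] a6 show ?thesis
      by blast
  qed
qed

lemma C30_diag_pair:
  assumes "c \<in> C30"
  obtains z where "c = coords (diag_pair z)"
proof -
  obtain a1 a2 a3 a4 a5 a6 a7 a8 a9 where c: "c = (a1, a2, a3, a4, a5, a6, a7, a8, a9, 0, 0)"
    and e: "a3 * a9 - 2 * a4 * a8 + a5 * a7 = 0" "a5 * a6 - 2 * a4 * a7 + a3 * a8 = 0"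
     "a3^2 * a5 - a3 * a4^2 + 6 * a6 * a8 - 6 * a7^2 = 0"
     "a3 * a4 * a5 - a4^3 + 3 * a6 * a9 - 3 * a7 * a8 = 0"
     "a3 * a5^2 - a4^2 * a5 + 6 * a7 * a9 - 6 * a8^2 = 0"
    using assms unfolding C30_def by blast
  from C30_power_sums[OF e] obtain x1 x2 x3 y1 y2 y3 where
    xy: "x1 + x2 + x3 = 0" "y1 + y2 + y3 = 0" and
    s: "x1 * x1 + x2 * x2 + x3 * x3 = a3" "x1 * y1 + x2 * y2 + x3 * y3 = a4"
    "y1 * y1 + y2 * y2 + y3 * y3 = a5"
    "x1 * x1 * x1 + x2 * x2 * x2 + x3 * x3 * x3 = a6"
    "x1 * x1 * y1 + x2 * x2 * y2 + x3 * x3 * y3 = a7"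
    "x1 * y1 * y1 + x2 * y2 * y2 + x3 * y3 * y3 = a8"
    "y1 * y1 * y1 + y2 * y2 * y2 + y3 * y3 * y3 = a9"
    by blast
  from coords_centred[OF xy, of a1 a2, unfolded s] obtain z where "coords (diag_pair z) = c"
    unfolding c by blast
  then show thesis
    by (rule that[OF sym])
qed

section \<open>The three orbits\<close>

lemma distinct_triple_power_sums:
  obtains e :: "3 \<Rightarrow> complex"
  where "inj e" "(\<Sum>i\<in>UNIV. e i) = 0" "(\<Sum>i\<in>UNIV. e i * e i) = 0" "(\<Sum>i\<in>UNIV. e i * e i * e i) = 1"
proof -
  obtain y1 y2 y3 :: complex where y: "y1 + y2 + y3 = 0" "y1 * y1 + y2 * y2 + y3 * y3 = 0"
    "y1 * y1 * y1 + y2 * y2 * y2 + y3 * y3 * y3 = 1"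
    by (rule cubic_power_sums)
  \<comment> \<open>Two equal entries would give a triple a, a, - 2 a with square sum 6 a^2 = 0, so
    all entries and the sum of cubes would vanish.\<close>
  have "y1 \<noteq> y2" "y1 \<noteq> y3" "y2 \<noteq> y3"
    using y by algebra+
  define e :: "3 \<Rightarrow> complex" where "e i = (if i = 1 then y1 else if i = 2 then y2 else y3)" for i
  have e: "e 1 = y1" "e 2 = y2" "e 3 = y3"
    by (simp_all add: e_def)
  have "inj e"
    using \<open>y1 \<noteq> y2\<close> \<open>y1 \<noteq> y3\<close> \<open>y2 \<noteq> y3\<close> by (auto simp: inj_def forall_3 e)
  with y show ?thesis
    by (intro that[of e]) (simp_all add: sum_3 e)
qed

text \<open>A centred triple with entries u, u, - 2 u has power sums 6 u^2 and - 6 u^3. Normalising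
  the latter to 1 suggests this \<open>u\<close>, and then 6 u^2 is the cube root of 6.\<close>

lemma coords_double_point:
  fixes k :: 3
  defines "u \<equiv> - 1 / complex_of_real (root 3 6)"
  shows "coords (diag_pair (\<lambda>i. (0, if i = k then - 2 * u else u)))
    = (0, 0, 0, 0, complex_of_real (root 3 6), 0, 0, 0, 1, 0, 0)"
proof -
  define r where "r = complex_of_real (root 3 6)"
  have "root 3 6 ^ 3 = (6::real)"
    by simp
  then have r3: "r * r * r = 6"
    unfolding r_def by (simp flip: of_real_mult add: power3_eq_cube)
  then have "r \<noteq> 0"
    by auto
  have u: "u * r = - 1"
    using \<open>r \<noteq> 0\<close> by (simp add: u_def r_def)
  have "6 * (u * u) = r" "- 6 * (u * u * u) = 1"
    using u r3 by algebra+
  have k: "k = 1 \<or> k = 2 \<or> k = 3"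
    using exhaust_3 by blast
  let ?e = "\<lambda>i. if i = k then - 2 * u else u"
  have "(\<Sum>i\<in>UNIV. ?e i) = 0"
    using k by (auto simp: sum_3)
  moreover have "(\<Sum>i\<in>UNIV. ?e i * ?e i) = 6 * (u * u)"
    using k by (auto simp: sum_3)
  moreover have "(\<Sum>i\<in>UNIV. ?e i * ?e i * ?e i) = - 6 * (u * u * u)"
    using k by (auto simp: sum_3)
  ultimately show ?thesis
    unfolding r_def[symmetric] \<open>6 * (u * u) = r\<close> \<open>- 6 * (u * u * u) = 1\<close>
    by (simp add: coords_vertical)
qed

text \<open>The index \<open>k\<close> of the isolated point treats the three ways of having exactly
  two equal points uniformly.\<close>

lemma triple_patterns:
  fixes z :: "3 \<Rightarrow> 'a"
  obtains "\<And>i j. z i = z j"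
    | k where "\<And>i j. z i = z j \<longleftrightarrow> (i = k \<longleftrightarrow> j = k)"
    | "inj z"
proof -
  consider "z 1 = z 2 \<and> z 2 = z 3" | "z 1 = z 2 \<and> z 3 \<noteq> z 2" | "z 1 = z 3 \<and> z 2 \<noteq> z 3"
    | "z 2 = z 3 \<and> z 1 \<noteq> z 2" | "z 1 \<noteq> z 2 \<and> z 1 \<noteq> z 3 \<and> z 2 \<noteq> z 3"
    by metis
  then show thesis
  proof cases
    case 1
    then have "\<forall>i j. z i = z j" unfolding forall_3 by simp
    then show ?thesis using that(1) by blast
  next
    case 2
    then have "\<forall>i j. z i = z j \<longleftrightarrow> (i = 3 \<longleftrightarrow> j = 3)" unfolding forall_3 by auto
    then show ?thesis using that(2)[of 3] by blast
  next
    case 3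
    then have "\<forall>i j. z i = z j \<longleftrightarrow> (i = 2 \<longleftrightarrow> j = 2)" unfolding forall_3 by auto
    then show ?thesis using that(2)[of 2] by blast
  next
    case 4
    then have "\<forall>i j. z i = z j \<longleftrightarrow> (i = 1 \<longleftrightarrow> j = 1)" unfolding forall_3 by auto
    then show ?thesis using that(2)[of 1] by blast
  next
    case 5
    then have "inj z" unfolding inj_def forall_3 by auto
    then show ?thesis using that(3) by blast
  qed
qed

lemma orbit_eq_of_pattern:
  assumes "\<And>i j. z i = z j \<longleftrightarrow> e i = e j"
  shows "orbit cremona_group cremona_action (coords (diag_pair z))
    = orbit cremona_group cremona_action (coords (diag_pair (\<lambda>i. (0, e i))))"
proof -
  have "\<exists>\<tau>\<in>tame. \<tau> \<circ> z = (\<lambda>i. (0, e i))"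
    by (rule tame_transitive) (rule assms)
  then obtain \<tau> where \<tau>: "\<tau> \<in> tame" and z: "\<tau> \<circ> z = (\<lambda>i. (0, e i))"
    by (rule bexE)
  show ?thesis
    unfolding z[symmetric] by (rule orbit_diag_pair_eq[OF \<tau>, symmetric])
qed

theorem theorem5p4:
  shows "let P0 = (0, 0, 0, 0, 0, 0, 0, 0, 0, 0, 0) :: point;
             P1 = (0, 0, 0, 0, complex_of_real (root 3 6), 0, 0, 0, 1, 0, 0) :: point;
             P2 = (0, 0, 0, 0, 0, 0, 0, 0, 1, 0, 0) :: point
         in orbits cremona_group C30 cremona_action =
              {orbit cremona_group cremona_action P0,
               orbit cremona_group cremona_action P1,
               orbit cremona_group cremona_action P2} \<and>
            distinct [orbit cremona_group cremona_action P0,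
                      orbit cremona_group cremona_action P1,
                      orbit cremona_group cremona_action P2]"
proof -
  define P0 P1 P2 :: point where "P0 = (0, 0, 0, 0, 0, 0, 0, 0, 0, 0, 0)"
    and "P1 = (0, 0, 0, 0, complex_of_real (root 3 6), 0, 0, 0, 1, 0, 0)"
    and "P2 = (0, 0, 0, 0, 0, 0, 0, 0, 1, 0, 0)"
  let ?orb = "orbit cremona_group cremona_action"
  define u where "u = - 1 / complex_of_real (root 3 6)"
  have u: "u \<noteq> 0"
    by (simp add: u_def)
  let ?e1 = "\<lambda>k i. if i = k then - 2 * u else u"
  obtain e2 :: "3 \<Rightarrow> complex" where e2: "inj e2" "(\<Sum>i\<in>UNIV. e2 i) = 0"
    "(\<Sum>i\<in>UNIV. e2 i * e2 i) = 0" "(\<Sum>i\<in>UNIV. e2 i * e2 i * e2 i) = 1"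
    by (rule distinct_triple_power_sums)
  have P0: "coords (diag_pair (\<lambda>i. (0, 0))) = P0"
    by (simp add: coords_vertical P0_def)
  \<comment> \<open>The position \<open>k\<close> of the isolated point does not matter, as power
    sums are symmetric; this lets any triple of this pattern reach the same normal form.\<close>
  have P1: "coords (diag_pair (\<lambda>i. (0, ?e1 k i))) = P1" for k
    unfolding P1_def u_def by (rule coords_double_point)
  have P2: "coords (diag_pair (\<lambda>i. (0, e2 i))) = P2"
    using e2 by (simp add: coords_vertical P2_def)
  have e1: "?e1 k i = ?e1 k j \<longleftrightarrow> (i = k \<longleftrightarrow> j = k)" for i j k :: 3
    using u by auto

  have "P0 \<in> mat_quotient" "P1 \<in> mat_quotient" "P2 \<in> mat_quotient"
    unfolding mat_quotient_def using P0 P1 P2 by (metis rangeI)+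
  then have "P0 \<in> C30" "P1 \<in> C30" "P2 \<in> C30"
    by (simp_all add: C30_def P0_def P1_def P2_def)
  moreover have "?orb c \<in> {?orb P0, ?orb P1, ?orb P2}" if C30: "c \<in> C30" for c
  proof -
    obtain z where c: "c = coords (diag_pair z)"
      using C30 by (rule C30_diag_pair)
    show ?thesis
    proof (cases z rule: triple_patterns)
      case 1
      then have "?orb c = ?orb P0"
        unfolding c P0[symmetric] by (intro orbit_eq_of_pattern) simp
      then show ?thesis by simp
    next
      case (2 k)
      then have "?orb c = ?orb P1"
        unfolding c P1[of k, symmetric] by (intro orbit_eq_of_pattern) (simp only: e1)
      then show ?thesis by simp
    next
      case 3
      then have "?orb c = ?orb P2"
        unfolding c P2[symmetric] using e2(1) by (intro orbit_eq_of_pattern) (simp add: inj_eq)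
      then show ?thesis by simp
    qed
  qed
  ultimately have "orbits cremona_group C30 cremona_action = {?orb P0, ?orb P1, ?orb P2}"
    unfolding orbits_def by blast

  moreover have mem: "coords (diag_pair z) \<in> ?orb (coords (diag_pair z))" for z
    unfolding orbit_diag_pair by (rule image_eqI[OF _ tame_id]) simp
  \<comment> \<open>Three coincident points stay coincident under any map, so their centred
    coordinates vanish, while \<open>P1\<close> and \<open>P2\<close> have a9 = 1.\<close>
  have P0_orbit: "P \<noteq> P1 \<and> P \<noteq> P2" if "P \<in> ?orb P0" for P
    using that unfolding P0[symmetric] orbit_diag_pair
    by (auto simp: coords_diag_pair P1_def P2_def)
  have "?orb P0 \<noteq> ?orb P1" "?orb P0 \<noteq> ?orb P2"
    using P0_orbit mem P1 P2 by metis+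
  moreover have "?orb P1 \<noteq> ?orb P2"
  proof
    assume "?orb P1 = ?orb P2"
    then have "P2 \<in> ?orb (coords (diag_pair (\<lambda>i. (0, ?e1 3 i))))"
      using mem P2 P1 by metis
    then obtain \<tau> :: "complex \<times> complex \<Rightarrow> complex \<times> complex"
      where t: "P2 = coords (diag_pair (\<tau> \<circ> (\<lambda>i. (0, ?e1 3 i))))"
      unfolding orbit_diag_pair by (rule imageE)
    define w :: "3 \<Rightarrow> complex \<times> complex" where "w = \<tau> \<circ> (\<lambda>i. (0, ?e1 3 i))"
    define y where "y i = snd (w i) - (\<Sum>j\<in>UNIV. snd (w j)) / 3" for i
    have "coords (diag_pair w) = P2"
      unfolding t w_def ..
    then have "(\<Sum>i\<in>UNIV. y i * y i) = 0" "(\<Sum>i\<in>UNIV. y i * y i * y i) = 1"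
      unfolding P2_def coords_diag_pair prod.inject y_def by blast+
    then have sq: "y 1 * y 1 + y 2 * y 2 + y 3 * y 3 = 0"
      and cube: "y 1 * y 1 * y 1 + y 2 * y 2 * y 2 + y 3 * y 3 * y 3 = 1"
      unfolding sum_3 .
    \<comment> \<open>With the isolated point at index 3 the first two points agree, and so do their
      images. The centred second coordinates are therefore y, y, - 2 y, and a5 = 0 contradicts a9 =
      1.\<close>
    have "w 1 = w 2"
      by (simp add: w_def)
    then have y2: "y 2 = y 1"
      by (simp add: y_def)
    have "y 1 + y 2 + y 3 = 0"
      by (simp add: y_def sum_3 field_simps)
    then have y3: "y 3 = - 2 * y 1"
      unfolding y2 by algebra
    have "6 * (y 1 * y 1) = 0"
      using sq unfolding y2 y3 by algebra
    then have "y 1 = 0"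
      by simp
    with cube show False
      unfolding y2 y3 by simp
  qed
  ultimately show ?thesis
    unfolding Let_def P0_def P1_def P2_def by simp
qed

end
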